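(* For every integer $k\ge0$ and every integer $n>0$, the $B$-term $(B^kB)^{(k+2)n}$ does not have the $\rho$-property.
   Context: $B=\lambda f.\lambda g.\lambda x.\, f\,(g\,x)$; $B$-terms are combinatory terms built from $B$ by application, compared up to $\beta\eta$-equivalence. $e_1\circ e_2$ denotes $B\,e_1\,e_2$; $B^0B=B$, $B^{j+1}B=B\,(B^jB)$; for a $B$-term $e$ and $r\ge1$, $e^r$ denotes the $r$-fold composition $e\circ\cdots\circ e$. For a term $X$ and $i\ge1$, $X_{(i)}$ denotes $X\,X\cdots X$ ($i$ copies, left-associated). $X$ has the $\rho$-property if there exist distinct positive integers $i,j$ with $X_{(i)}$ and $X_{(j)}$ $\beta\eta$-equivalent. *)

theory Defs
  imports Main
begin

section \<open>Untyped lambda terms up to beta-eta equivalence\<close>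

text \<open>De Bruijn representation: \<open>Var i\<close> refers to the \<open>i\<close>-th enclosing \<open>Lam\<close>, counting from 0.\<close>

datatype lam = Var nat | App lam lam (infixl \<open>\<cdot>\<close> 200) | Lam lam

primrec lift :: "lam \<Rightarrow> nat \<Rightarrow> lam" where
  "lift (Var i) c = (if i < c then Var i else Var (Suc i))"
| "lift (s \<cdot> t) c = lift s c \<cdot> lift t c"
| "lift (Lam s) c = Lam (lift s (Suc c))"

text \<open>\<open>subst s u c\<close> replaces index \<open>c\<close> in \<open>s\<close> by \<open>u\<close> and lowers the indices above \<open>c\<close>,
  as needed when the binder of \<open>c\<close> is removed.\<close>

primrec subst :: "lam \<Rightarrow> lam \<Rightarrow> nat \<Rightarrow> lam" where
  "subst (Var i) u c = (if c < i then Var (i - 1) else if i = c then u else Var i)"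
| "subst (s \<cdot> t) u c = subst s u c \<cdot> subst t u c"
| "subst (Lam s) u c = Lam (subst s (lift u 0) (Suc c))"

text \<open>In \<open>eta\<close>, the usual side condition that the bound variable is not free in \<open>s\<close> is expressed
  by lifting \<open>s\<close>.\<close>

inductive beta_eta_eq :: "lam \<Rightarrow> lam \<Rightarrow> bool" (infix \<open>=\<^sub>\<beta>\<^sub>\<eta>\<close> 50) where
  beta: "Lam s \<cdot> t =\<^sub>\<beta>\<^sub>\<eta> subst s t 0"
| eta: "Lam (lift s 0 \<cdot> Var 0) =\<^sub>\<beta>\<^sub>\<eta> s"
| refl: "s =\<^sub>\<beta>\<^sub>\<eta> s"
| sym: "s =\<^sub>\<beta>\<^sub>\<eta> t \<Longrightarrow> t =\<^sub>\<beta>\<^sub>\<eta> s"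
| trans: "s =\<^sub>\<beta>\<^sub>\<eta> t \<Longrightarrow> t =\<^sub>\<beta>\<^sub>\<eta> u \<Longrightarrow> s =\<^sub>\<beta>\<^sub>\<eta> u"
| app: "s =\<^sub>\<beta>\<^sub>\<eta> s' \<Longrightarrow> t =\<^sub>\<beta>\<^sub>\<eta> t' \<Longrightarrow> s \<cdot> t =\<^sub>\<beta>\<^sub>\<eta> s' \<cdot> t'"
| xi: "s =\<^sub>\<beta>\<^sub>\<eta> s' \<Longrightarrow> Lam s =\<^sub>\<beta>\<^sub>\<eta> Lam s'"

section \<open>The rho-property\<close>

text \<open>\<open>self_app X i\<close> is \<open>X X \<dots> X\<close> with \<open>i\<close> copies of \<open>X\<close>, associated to the left.
  It is meant for \<open>i \<ge> 1\<close>.\<close>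

definition self_app :: "lam \<Rightarrow> nat \<Rightarrow> lam" where
  "self_app X i = ((\<lambda>Y. Y \<cdot> X) ^^ (i - 1)) X"

definition rho_property :: "lam \<Rightarrow> bool" where
  "rho_property X \<longleftrightarrow> (\<exists>i j. 0 < i \<and> 0 < j \<and> i \<noteq> j \<and> self_app X i =\<^sub>\<beta>\<^sub>\<eta> self_app X j)"

section \<open>B-terms\<close>

datatype bterm = B | BApp bterm bterm (infixl \<open>\<bullet>\<close> 200)

text \<open>The constant \<open>B\<close> stands for \<open>\<lambda>f. \<lambda>g. \<lambda>x. f (g x)\<close>.\<close>

primrec lam_of :: "bterm \<Rightarrow> lam" where
  "lam_of B = Lam (Lam (Lam (Var 2 \<cdot> (Var 1 \<cdot> Var 0))))"
| "lam_of (e\<^sub>1 \<bullet> e\<^sub>2) = lam_of e\<^sub>1 \<cdot> lam_of e\<^sub>2"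

definition bcomp :: "bterm \<Rightarrow> bterm \<Rightarrow> bterm" (infixr \<open>\<circ>\<^sub>B\<close> 55) where
  "e\<^sub>1 \<circ>\<^sub>B e\<^sub>2 = B \<bullet> e\<^sub>1 \<bullet> e\<^sub>2"

text \<open>\<open>B_iter k\<close> is the term usually written \<open>B\<^sup>k B\<close>: \<open>k\<close> applications of \<open>B\<close> to \<open>B\<close>.\<close>

primrec B_iter :: "nat \<Rightarrow> bterm" where
  "B_iter 0 = B"
| "B_iter (Suc j) = B \<bullet> B_iter j"

text \<open>\<open>bpow e r\<close> is the composition of \<open>r\<close> copies of \<open>e\<close>, meant for \<open>r \<ge> 1\<close>. It is nested to
  the right; composition is associative up to beta-eta equivalence.\<close>

definition bpow :: "bterm \<Rightarrow> nat \<Rightarrow> bterm" where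
  "bpow e r = ((\<lambda>f. e \<circ>\<^sub>B f) ^^ (r - 1)) e"

end

theory Submission imports Defs "HOL-Library.Confluence" begin

text \<open>A B-term \<open>X\<close> applied to sufficiently many variables reduces to \<open>x\<^sub>0 t\<^sub>1 \<dots> t\<^sub>m\<close>, where the
  forest \<open>t\<^sub>1, \<dots>, t\<^sub>m\<close> of applications contains the remaining variables in order. By confluence of
  beta-eta reduction the forest is determined by \<open>X\<close> up to trailing leaves. For
  \<open>X = (B\<^sup>kB)\<^sup>N\<close>, right application to \<open>X\<close> acts on forests as follows: the first tree is
  replaced by the arguments of its head variable, and the tree at position \<open>k + 1\<close> (counting from 0)
  takes the following \<open>N\<close> trees as additional arguments. If \<open>k + 2\<close> divides \<open>N\<close>, then along the
  orbit of \<open>X\<close> the absorbing tree is always a leaf, so that every variable has \<open>0\<close> or \<open>N\<close> arguments.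
  Hence each step either increases the number of edges, or preserves it and decreases the
  left depth of the first tree; no forest can recur.\<close>

section \<open>Confluence of beta-eta reduction\<close>

lemma lift_lift: "i \<le> c \<Longrightarrow> lift (lift s i) (Suc c) = lift (lift s c) i"
  by (induction s arbitrary: i c) auto

lemma size_lift [simp]: "size (lift s c) = size s"
  by (induction s arbitrary: c) auto

lemma subst_lift [simp]: "subst (lift s c) u c = s"
  by (induction s arbitrary: c u) auto

lemma subst_lift_Var [simp]: "subst (lift s (Suc c)) (Var c) c = s"
  by (induction s arbitrary: c) auto

lemma lift_inject [simp]: "lift s c = lift t c \<longleftrightarrow> s = t"
  by (metis subst_lift)

lemma lift_subst: "i \<le> c \<Longrightarrow> lift (subst s u i) c = subst (lift s (Suc c)) (lift u c) i"
  by (induction s arbitrary: i c u) (auto simp: lift_lift)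

lemma subst_of_lift: "i \<le> c \<Longrightarrow> subst (lift s i) (lift u i) (Suc c) = lift (subst s u c) i"
  by (induction s arbitrary: i c u) (auto simp: lift_lift[symmetric])

lemma subst_subst:
  "i \<le> c \<Longrightarrow> subst (subst s t i) u c = subst (subst s (lift u i) (Suc c)) (subst t u c) i"
proof (induction s arbitrary: i c t u)
  case (Lam s)
  then show ?case by (simp add: lift_lift subst_of_lift[of 0, symmetric])
qed auto

text \<open>A term avoiding two distinct variables is a lift at both. This serves the eta case of
  \<open>par_lift_inv\<close>.\<close>

lemma lift_eq_liftE:
  assumes "lift s (Suc c) = lift q i" "i \<le> c"
  obtains r where "s = lift r i" "q = lift r c"
proof -
  have "\<exists>r. s = lift r i \<and> q = lift r c"
    using assms
  proof (induction s arbitrary: q i c)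
    case (Var x)
    show ?case
    proof (cases q)
      case (Var y)
      with Var.prems show ?thesis
        by (intro exI[of _ "Var (if x < i then x else x - 1)"]) (auto split: if_splits)
    qed (use Var in \<open>auto split: if_splits\<close>)
  next
    case (App s1 s2)
    then obtain q1 q2 where q: "q = q1 \<cdot> q2" "lift s1 (Suc c) = lift q1 i" "lift s2 (Suc c) = lift q2 i"
      by (cases q) (auto split: if_splits)
    obtain r1 r2 where "s1 = lift r1 i" "q1 = lift r1 c" "s2 = lift r2 i" "q2 = lift r2 c"
      using App.IH q App.prems by blast
    then show ?case using q by (intro exI[of _ "r1 \<cdot> r2"]) auto
  next
    case (Lam s)
    then obtain q1 where q: "q = Lam q1" "lift s (Suc (Suc c)) = lift q1 (Suc i)"
      by (cases q) (auto split: if_splits)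
    then obtain r where "s = lift r (Suc i)" "q1 = lift r (Suc c)"
      using Lam by blast
    then show ?case using q by (intro exI[of _ "Lam r"]) auto
  qed
  then show thesis using that by blast
qed

text \<open>Parallel reduction in the style of Tait and Martin-Loef, extended by eta: contracting
  several redexes at once lets a one-step divergence close in one step.\<close>

inductive par :: "lam \<Rightarrow> lam \<Rightarrow> bool" (infix \<open>\<Rightarrow>\<^sub>p\<close> 50) where
  par_Var: "Var i \<Rightarrow>\<^sub>p Var i"
| par_App: "s \<Rightarrow>\<^sub>p s' \<Longrightarrow> t \<Rightarrow>\<^sub>p t' \<Longrightarrow> s \<cdot> t \<Rightarrow>\<^sub>p s' \<cdot> t'"
| par_Lam: "s \<Rightarrow>\<^sub>p s' \<Longrightarrow> Lam s \<Rightarrow>\<^sub>p Lam s'"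
| par_beta: "s \<Rightarrow>\<^sub>p s' \<Longrightarrow> t \<Rightarrow>\<^sub>p t' \<Longrightarrow> Lam s \<cdot> t \<Rightarrow>\<^sub>p subst s' t' 0"
| par_eta: "s \<Rightarrow>\<^sub>p s' \<Longrightarrow> Lam (lift s 0 \<cdot> Var 0) \<Rightarrow>\<^sub>p s'"

inductive_cases par_VarE: "Var i \<Rightarrow>\<^sub>p t"

lemma par_AppE:
  assumes "a \<cdot> b \<Rightarrow>\<^sub>p t"
  obtains (app) a' b' where "t = a' \<cdot> b'" "a \<Rightarrow>\<^sub>p a'" "b \<Rightarrow>\<^sub>p b'"
  | (beta) r r' b' where "a = Lam r" "t = subst r' b' 0" "r \<Rightarrow>\<^sub>p r'" "b \<Rightarrow>\<^sub>p b'"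
  using assms by (cases rule: par.cases) auto

lemma par_LamE:
  assumes "Lam a \<Rightarrow>\<^sub>p t"
  obtains (lam) a' where "t = Lam a'" "a \<Rightarrow>\<^sub>p a'"
  | (eta) q where "a = lift q 0 \<cdot> Var 0" "q \<Rightarrow>\<^sub>p t"
  using assms by (cases rule: par.cases) auto

lemma par_refl [simp]: "s \<Rightarrow>\<^sub>p s"
  by (induction s) (auto intro: par.intros)

lemma par_lift: "s \<Rightarrow>\<^sub>p t \<Longrightarrow> lift s c \<Rightarrow>\<^sub>p lift t c"
proof (induction arbitrary: c rule: par.induct)
  case (par_eta s s')
  then show ?case using par.par_eta[of "lift s c"] by (simp add: lift_lift)
qed (auto intro: par.intros simp: lift_subst)

lemma par_subst: "s \<Rightarrow>\<^sub>p s' \<Longrightarrow> u \<Rightarrow>\<^sub>p u' \<Longrightarrow> subst s u c \<Rightarrow>\<^sub>p subst s' u' c"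
proof (induction arbitrary: c u u' rule: par.induct)
  case (par_eta s s')
  then show ?case using par.par_eta[of "subst s u c"] by (simp add: subst_of_lift)
next
  case (par_Lam s s')
  then show ?case by (simp add: par.par_Lam par_lift)
next
  case (par_beta s s' t t')
  have "subst s (lift u 0) (Suc c) \<Rightarrow>\<^sub>p subst s' (lift u' 0) (Suc c)"
    using par_beta by (blast intro: par_lift)
  with par_beta show ?case by (simp add: par.par_beta subst_subst[of 0])
qed (auto intro: par.intros)

text \<open>Reduction creates no free variables, so a reduct still avoids index
  \<open>c\<close>.\<close>

lemma par_lift_inv:
  assumes "lift s c \<Rightarrow>\<^sub>p t"
  obtains t' where "t = lift t' c" "s \<Rightarrow>\<^sub>p t'"
proof -
  have "\<exists>t'. t = lift t' c \<and> s \<Rightarrow>\<^sub>p t'"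
    using assms
  proof (induction "lift s c" t arbitrary: s c rule: par.induct)
    case (par_Var i)
    then show ?case by (metis par_refl)
  next
    case (par_App u u' v v')
    then obtain s1 s2 where s: "s = s1 \<cdot> s2" "u = lift s1 c" "v = lift s2 c"
      by (cases s) (auto split: if_splits)
    with par_App(2)[of s1 c] par_App(4)[of s2 c] show ?case
      by (metis lift.simps(2) par.par_App)
  next
    case (par_Lam u u')
    then obtain s1 where s: "s = Lam s1" "u = lift s1 (Suc c)"
      by (cases s) (auto split: if_splits)
    with par_Lam(2)[of s1 "Suc c"] show ?case
      by (metis lift.simps(3) par.par_Lam)
  next
    case (par_beta u u' v v')
    then obtain q s2 where s: "s = q \<cdot> s2" "Lam u = lift q c" "v = lift s2 c"
      by (cases s) (auto split: if_splits)
    then obtain s1 where q: "q = Lam s1" "u = lift s1 (Suc c)"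
      by (cases q) (auto split: if_splits)
    from par_beta(2)[OF q(2)] par_beta(4)[OF s(3)] obtain r1 r2 where
      "u' = lift r1 (Suc c)" "s1 \<Rightarrow>\<^sub>p r1" "v' = lift r2 c" "s2 \<Rightarrow>\<^sub>p r2" by blast
    then show ?case using s q
      by (intro exI[of _ "subst r1 r2 0"]) (auto simp: lift_subst intro: par.par_beta)
  next
    case (par_eta u u')
    then obtain s0 where s0: "s = Lam s0" "lift u 0 \<cdot> Var 0 = lift s0 (Suc c)"
      by (cases s) (auto split: if_splits)
    then obtain s1 s2 where s: "s0 = s1 \<cdot> s2" "lift s1 (Suc c) = lift u 0" "lift s2 (Suc c) = Var 0"
      by (cases s0) (auto split: if_splits)
    then have s2: "s2 = Var 0" by (cases s2) (auto split: if_splits)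
    obtain r where r: "s1 = lift r 0" "u = lift r c"
      using lift_eq_liftE[OF s(2)] by blast
    from par_eta(2)[OF r(2)] obtain t' where "u' = lift t' c" "r \<Rightarrow>\<^sub>p t'" by blast
    then show ?case using s0 s s2 r par.par_eta by blast
  qed
  then show thesis using that by blast
qed

text \<open>The second alternative arises when \<open>u\<close> is an abstraction and the body is
  contracted as a beta-redex: the argument is the bound variable, so this merely renames.\<close>

lemma par_eta_body:
  assumes "lift u 0 \<cdot> Var 0 \<Rightarrow>\<^sub>p w"
  shows "(\<exists>u'. u \<Rightarrow>\<^sub>p u' \<and> w = lift u' 0 \<cdot> Var 0) \<or> u \<Rightarrow>\<^sub>p Lam w"
  using assms
proof (cases rule: par_AppE)
  case (app s' t')
  then show ?thesis by (metis par_VarE par_lift_inv)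
next
  case (beta r r' t')
  obtain r0 where u: "u = Lam r0" "r = lift r0 (Suc 0)"
    using beta(1) by (cases u) (auto split: if_splits)
  obtain r0' where "r' = lift r0' (Suc 0)" "r0 \<Rightarrow>\<^sub>p r0'"
    using beta u par_lift_inv by blast
  moreover have "t' = Var 0" using beta by (auto elim: par_VarE)
  ultimately show ?thesis using beta u by (auto intro: par_Lam)
qed

text \<open>The induction is on size, not on derivations, because the eta cases use reductions that
  are built anew. \<open>app_beta\<close> and \<open>lam_eta\<close> treat the overlapping
  redexes.\<close>

lemma par_diamond: "s \<Rightarrow>\<^sub>p t \<Longrightarrow> s \<Rightarrow>\<^sub>p u \<Longrightarrow> \<exists>v. t \<Rightarrow>\<^sub>p v \<and> u \<Rightarrow>\<^sub>p v"
proof (induction "size s" arbitrary: s t u rule: less_induct)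
  case less
  have IH: "\<exists>v. t' \<Rightarrow>\<^sub>p v \<and> u' \<Rightarrow>\<^sub>p v" if "size s' < size s" "s' \<Rightarrow>\<^sub>p t'" "s' \<Rightarrow>\<^sub>p u'" for s' t' u'
    using less.hyps that by blast
  have app_beta: "\<exists>v. p \<cdot> b1 \<Rightarrow>\<^sub>p v \<and> subst a' b2 0 \<Rightarrow>\<^sub>p v"
    if s: "s = Lam a \<cdot> b" and p: "Lam a \<Rightarrow>\<^sub>p p" and b: "b \<Rightarrow>\<^sub>p b1" "b \<Rightarrow>\<^sub>p b2" and a: "a \<Rightarrow>\<^sub>p a'"
    for p a a' b b1 b2
  proof -
    obtain b3 where b3: "b1 \<Rightarrow>\<^sub>p b3" "b2 \<Rightarrow>\<^sub>p b3" using IH[OF _ b] s by auto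
    from p show ?thesis
    proof (cases rule: par_LamE)
      case (lam a'')
      then obtain a3 where "a'' \<Rightarrow>\<^sub>p a3" "a' \<Rightarrow>\<^sub>p a3" using IH[of a a'' a'] s a by auto
      then show ?thesis using lam b3 par_beta par_subst by blast
    next
      case (eta q)
      \<comment> \<open>Instead of contracting the eta-redex, one reduces inside its body;
        substituting \<open>b1\<close> there yields \<open>p \<cdot> b1\<close> again.\<close>
      have "a \<Rightarrow>\<^sub>p lift p 0 \<cdot> Var 0" using eta by (auto intro: par_App par_lift)
      then obtain a3 where "lift p 0 \<cdot> Var 0 \<Rightarrow>\<^sub>p a3" "a' \<Rightarrow>\<^sub>p a3" using IH[of a _ a'] s a by auto
      then have "subst (lift p 0 \<cdot> Var 0) b1 0 \<Rightarrow>\<^sub>p subst a3 b3 0" "subst a' b2 0 \<Rightarrow>\<^sub>p subst a3 b3 0"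
        using b3 par_subst by blast+
      then show ?thesis by auto
    qed
  qed
  have lam_eta: "\<exists>v. p \<Rightarrow>\<^sub>p v \<and> Lam w \<Rightarrow>\<^sub>p v"
    if s: "s = Lam (lift q 0 \<cdot> Var 0)" and p: "q \<Rightarrow>\<^sub>p p" and w: "lift q 0 \<cdot> Var 0 \<Rightarrow>\<^sub>p w" for p q w
    using par_eta_body[OF w]
  proof (elim disjE exE conjE)
    fix q' assume q': "q \<Rightarrow>\<^sub>p q'" "w = lift q' 0 \<cdot> Var 0"
    then obtain v where "p \<Rightarrow>\<^sub>p v" "q' \<Rightarrow>\<^sub>p v" using IH[of q p q'] s p by auto
    then show ?thesis using q' par_eta by blast
  next
    assume "q \<Rightarrow>\<^sub>p Lam w"
    then show ?thesis using IH[of q p "Lam w"] s p by auto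
  qed
  show ?case
  proof (cases s)
    case (Var i)
    then show ?thesis using less.prems by (metis par_VarE par_refl)
  next
    case (App a b)
    from less.prems(1)[unfolded App] show ?thesis
    proof (cases rule: par_AppE)
      case t: (app a1 b1)
      from less.prems(2)[unfolded App] show ?thesis
      proof (cases rule: par_AppE)
        case u: (app a2 b2)
        then show ?thesis using t App IH[of a a1 a2] IH[of b b1 b2] by (auto intro: par_App)
      next
        case u: (beta a0 a2 b2)
        then show ?thesis using t App app_beta[of a0 b a1 b1 b2 a2] by auto
      qed
    next
      case t: (beta a0 a1 b1)
      from less.prems(2)[unfolded App] show ?thesis
      proof (cases rule: par_AppE)
        case u: (app a2 b2)
        then show ?thesis using t App app_beta[of a0 b a2 b2 b1 a1] by auto
      next
        case u: (beta a0 a2 b2)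
        then show ?thesis using t App IH[of a0 a1 a2] IH[of b b1 b2] par_subst by fastforce
      qed
    qed
  next
    case (Lam a)
    from less.prems(1)[unfolded Lam] show ?thesis
    proof (cases rule: par_LamE)
      case t: (lam a1)
      from less.prems(2)[unfolded Lam] show ?thesis
      proof (cases rule: par_LamE)
        case u: (lam a2)
        then show ?thesis using t Lam IH[of a a1 a2] by (auto intro: par_Lam)
      next
        case u: (eta q)
        then show ?thesis using t Lam lam_eta[of q u a1] by auto
      qed
    next
      case t: (eta q)
      from less.prems(2)[unfolded Lam] show ?thesis
      proof (cases rule: par_LamE)
        case u: (lam a2)
        then show ?thesis using t Lam lam_eta[of q t a2] by auto
      next
        case u: (eta q')
        then show ?thesis using t Lam IH[of q t u] by auto
      qed
    qed
  qed
qed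

section \<open>Confluence, the Church-Rosser property and normal terms\<close>

lemma confluentp_par: "confluentp par"
proof (rule strong_confluentp_imp_confluentp, rule strong_confluentpI)
  fix x y z
  assume "x \<Rightarrow>\<^sub>p y" "x \<Rightarrow>\<^sub>p z"
  then obtain u where "y \<Rightarrow>\<^sub>p u" "z \<Rightarrow>\<^sub>p u" using par_diamond by blast
  then show "\<exists>u. par\<^sup>*\<^sup>* y u \<and> par\<^sup>=\<^sup>= z u" by (intro exI[of _ u]) auto
qed

lemma par_star_App:
  assumes "par\<^sup>*\<^sup>* s s'" "par\<^sup>*\<^sup>* t t'"
  shows "par\<^sup>*\<^sup>* (s \<cdot> t) (s' \<cdot> t')"
proof -
  have "par\<^sup>*\<^sup>* (s \<cdot> t) (s' \<cdot> t)"
    using assms(1) by (induction rule: rtranclp_induct)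
      (simp, metis par_App par_refl rtranclp.rtrancl_into_rtrancl)
  also have "par\<^sup>*\<^sup>* (s' \<cdot> t) (s' \<cdot> t')"
    using assms(2) by (induction rule: rtranclp_induct)
      (simp, metis par_App par_refl rtranclp.rtrancl_into_rtrancl)
  finally show ?thesis .
qed

lemma par_star_Lam: "par\<^sup>*\<^sup>* s s' \<Longrightarrow> par\<^sup>*\<^sup>* (Lam s) (Lam s')"
  by (induction rule: rtranclp_induct) (auto intro: rtranclp.rtrancl_into_rtrancl par_Lam)

lemma church_rosser: "s =\<^sub>\<beta>\<^sub>\<eta> t \<Longrightarrow> \<exists>u. par\<^sup>*\<^sup>* s u \<and> par\<^sup>*\<^sup>* t u"
proof (induction rule: beta_eta_eq.induct)
  case (beta s t)
  then show ?case using par_beta[OF par_refl par_refl] by blast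
next
  case (eta s)
  then show ?case using par_eta[OF par_refl] by blast
next
  case (trans s t u)
  then obtain v w where v: "par\<^sup>*\<^sup>* s v" "par\<^sup>*\<^sup>* t v" and w: "par\<^sup>*\<^sup>* t w" "par\<^sup>*\<^sup>* u w" by blast
  obtain x where "par\<^sup>*\<^sup>* v x" "par\<^sup>*\<^sup>* w x" using confluentpD[OF confluentp_par v(2) w(1)] by blast
  then show ?case using v w by (blast intro: rtranclp_trans)
next
  case (app s s' t t')
  then show ?case by (meson par_star_App)
next
  case (xi s s')
  then show ?case by (meson par_star_Lam)
qed auto

text \<open>Beta- and eta-redexes both contain an abstraction, so these terms are normal, and
  convertible ones are equal by confluence.\<close>

primrec lamfree :: "lam \<Rightarrow> bool" where
  "lamfree (Var i) = True"
| "lamfree (s \<cdot> t) = (lamfree s \<and> lamfree t)"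
| "lamfree (Lam s) = False"

lemma par_star_lamfree: "par\<^sup>*\<^sup>* s t \<Longrightarrow> lamfree s \<Longrightarrow> t = s"
proof (induction rule: rtranclp_induct)
  case (step t u)
  have "t \<Rightarrow>\<^sub>p u \<Longrightarrow> lamfree t \<Longrightarrow> u = t" by (induction rule: par.induct) auto
  then show ?case using step by simp
qed simp

lemma lamfree_eq: "s =\<^sub>\<beta>\<^sub>\<eta> t \<Longrightarrow> lamfree s \<Longrightarrow> lamfree t \<Longrightarrow> s = t"
  using church_rosser par_star_lamfree by blast

section \<open>Trees of applications\<close>

abbreviation apps :: "lam \<Rightarrow> lam list \<Rightarrow> lam" where
  "apps \<equiv> foldl App"

lemma beta_eta_apps: "s =\<^sub>\<beta>\<^sub>\<eta> t \<Longrightarrow> apps s us =\<^sub>\<beta>\<^sub>\<eta> apps t us"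
  by (induction us arbitrary: s t) (auto intro: beta_eta_eq.app beta_eta_eq.refl)

text \<open>The two sides are the contracta of \<open>Lam s \<cdot> u\<close> and
  \<open>Lam t \<cdot> u\<close>, which \<open>xi\<close> relates.\<close>

lemma beta_eta_subst: "s =\<^sub>\<beta>\<^sub>\<eta> t \<Longrightarrow> subst s u 0 =\<^sub>\<beta>\<^sub>\<eta> subst t u 0"
  by (rule beta_eta_eq.trans[OF beta_eta_eq.sym[OF beta_eta_eq.beta]
        beta_eta_eq.trans[OF beta_eta_eq.app[OF beta_eta_eq.xi beta_eta_eq.refl] beta_eta_eq.beta]])

lemma subst_apps [simp]: "subst (apps s ts) u c = apps (subst s u c) (map (\<lambda>t. subst t u c) ts)"
  by (induction ts arbitrary: s) auto

lemma apps_Var_inject: "apps (Var n) xs = apps (Var n) ys \<longleftrightarrow> xs = ys"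
proof (induction xs arbitrary: ys rule: rev_induct)
  case Nil
  then show ?case by (cases ys rule: rev_cases) auto
next
  case (snoc x xs)
  then show ?case by (cases ys rule: rev_cases) auto
qed

section \<open>Trees, their measures and their labelling by variables\<close>

datatype tree = T "tree list"

primrec nodes :: "tree \<Rightarrow> nat" where
  "nodes (T us) = Suc (sum_list (map nodes us))"

primrec edges :: "tree \<Rightarrow> nat" where
  "edges (T us) = length us + sum_list (map edges us)"

fun left_depth :: "tree \<Rightarrow> nat" where
  "left_depth (T []) = 0"
| "left_depth (T (u # us)) = Suc (left_depth u)"

text \<open>The tree \<open>T [t\<^sub>1, \<dots>, t\<^sub>p]\<close> is read as \<open>x t\<^sub>1 \<dots> t\<^sub>p\<close>, where the variables of the whole
  term are numbered consecutively from left to right.\<close>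

fun lab :: "tree \<Rightarrow> nat \<Rightarrow> lam" and labs :: "tree list \<Rightarrow> nat \<Rightarrow> lam list" where
  "lab (T us) n = apps (Var n) (labs us (Suc n))"
| "labs [] n = []"
| "labs (t # ts) n = lab t n # labs ts (n + nodes t)"

lemma length_labs [simp]: "length (labs ts n) = length ts"
  by (induction ts arbitrary: n) auto

lemma labs_append [simp]: "labs (ts @ us) n = labs ts n @ labs us (n + sum_list (map nodes ts))"
  by (induction ts arbitrary: n) (auto simp: add.assoc)

lemma labs_replicate_leaf [simp]: "labs (replicate m (T [])) n = map Var [n..<n + m]"
  by (induction m arbitrary: n) (auto simp: upt_conv_Cons simp del: upt_Suc)

text \<open>Index 0 does not occur in \<open>lab t (Suc n)\<close>, so the substitution only
  renumbers.\<close>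

lemma subst_lab: "subst (lab t (Suc n)) u 0 = lab t n"
  and subst_labs: "map (\<lambda>s. subst s u 0) (labs ts (Suc n)) = labs ts n"
  by (induction t n and ts n rule: lab_labs.induct) auto

text \<open>A variable head determines its argument list. Equal first trees use equally many labels,
  so the remaining trees are numbered from the same index.\<close>

lemma lab_inject: "lab t n = lab t' n \<Longrightarrow> t = t'"
  and labs_inject: "labs ts n = labs ts' n \<Longrightarrow> ts = ts'"
proof (induction t n and ts n arbitrary: t' and ts' rule: lab_labs.induct)
  case (1 us n)
  then show ?case by (cases t') (auto simp: apps_Var_inject)
next
  case (2 n)
  then show ?case by (cases ts') auto
next
  case (3 t ts n)
  then obtain s ss where ts': "ts' = s # ss" by (cases ts') auto
  with 3 have "t = s" by auto
  with 3 ts' show ?case by auto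
qed

lemma lamfree_apps: "lamfree (apps s ts) \<longleftrightarrow> lamfree s \<and> (\<forall>t\<in>set ts. lamfree t)"
  by (induction ts arbitrary: s) auto

lemma lamfree_lab: "lamfree (lab t n)"
  and lamfree_labs: "\<forall>s\<in>set (labs ts n). lamfree s"
  by (induction t n and ts n rule: lab_labs.induct) (auto simp: lamfree_apps)

section \<open>Powers of iterated B\<close>

text \<open>Besides closedness, this computation rule is all that is used of the powers of
  \<open>B_iter k\<close>.\<close>

definition absorber :: "nat \<Rightarrow> nat \<Rightarrow> lam \<Rightarrow> bool" where
  "absorber k N X \<longleftrightarrow> (\<forall>y as w vs. length as = k \<longrightarrow> length vs = N \<longrightarrow>
     apps X (y # as @ w # vs) =\<^sub>\<beta>\<^sub>\<eta> apps y (as @ [apps w vs]))"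

lemma absorberD:
  "\<lbrakk>absorber k N X; length as = k; length vs = N\<rbrakk> \<Longrightarrow>
    apps X (y # as @ w # vs) =\<^sub>\<beta>\<^sub>\<eta> apps y (as @ [apps w vs])"
  by (simp add: absorber_def)

lemma B_apply: "lam_of B \<cdot> f \<cdot> g \<cdot> x =\<^sub>\<beta>\<^sub>\<eta> f \<cdot> (g \<cdot> x)"
proof -
  have 1: "lam_of B \<cdot> f =\<^sub>\<beta>\<^sub>\<eta> Lam (Lam (lift (lift f 0) 0 \<cdot> (Var 1 \<cdot> Var 0)))"
    using beta_eta_eq.beta[of "Lam (Lam (Var 2 \<cdot> (Var 1 \<cdot> Var 0)))" f] by (simp add: numeral_2_eq_2)
  have 2: "Lam (Lam (lift (lift f 0) 0 \<cdot> (Var 1 \<cdot> Var 0))) \<cdot> g =\<^sub>\<beta>\<^sub>\<eta> Lam (lift f 0 \<cdot> (lift g 0 \<cdot> Var 0))"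
    using beta_eta_eq.beta[of "Lam (lift (lift f 0) 0 \<cdot> (Var 1 \<cdot> Var 0))" g]
    by (simp add: lift_lift[of 0 0, symmetric])
  have 3: "Lam (lift f 0 \<cdot> (lift g 0 \<cdot> Var 0)) \<cdot> x =\<^sub>\<beta>\<^sub>\<eta> f \<cdot> (g \<cdot> x)"
    using beta_eta_eq.beta[of "lift f 0 \<cdot> (lift g 0 \<cdot> Var 0)" x] by simp
  have "lam_of B \<cdot> f \<cdot> g =\<^sub>\<beta>\<^sub>\<eta> Lam (lift f 0 \<cdot> (lift g 0 \<cdot> Var 0))"
    by (rule beta_eta_eq.trans[OF beta_eta_eq.app[OF 1 beta_eta_eq.refl] 2])
  then show ?thesis
    by (rule beta_eta_eq.trans[OF beta_eta_eq.app[OF _ beta_eta_eq.refl] 3])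
qed

text \<open>The outer \<open>B\<close> glues the leading argument \<open>a\<close> to
  \<open>y\<close>, which leaves \<open>B_iter k\<close> one argument fewer in front of
  \<open>w\<close>.\<close>

lemma absorber_B_iter: "absorber k 1 (lam_of (B_iter k))"
proof (induction k)
  case 0
  show ?case using B_apply by (auto simp: absorber_def length_Suc_conv)
next
  case (Suc k)
  show ?case
    unfolding absorber_def
  proof (intro allI impI)
    fix y w and as vs :: "lam list"
    assume "length as = Suc k" and vs: "length vs = 1"
    then obtain a as' where as: "as = a # as'" "length as' = k" by (auto simp: length_Suc_conv)
    have "apps (lam_of (B_iter (Suc k))) (y # as @ w # vs) =
        apps (lam_of B \<cdot> lam_of (B_iter k) \<cdot> y \<cdot> a) (as' @ w # vs)" using as by simp
    also have "\<dots> =\<^sub>\<beta>\<^sub>\<eta> apps (lam_of (B_iter k) \<cdot> (y \<cdot> a)) (as' @ w # vs)"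
      by (intro beta_eta_apps B_apply)
    finally have *: "apps (lam_of (B_iter (Suc k))) (y # as @ w # vs) =\<^sub>\<beta>\<^sub>\<eta>
      apps (lam_of (B_iter k)) ((y \<cdot> a) # as' @ w # vs)" by simp
    show "apps (lam_of (B_iter (Suc k))) (y # as @ w # vs) =\<^sub>\<beta>\<^sub>\<eta> apps y (as @ [apps w vs])"
      using beta_eta_eq.trans[OF * absorberD[OF Suc as(2) vs]] as by simp
  qed
qed

lemma bpow_Suc: "0 < r \<Longrightarrow> bpow e (Suc r) = e \<circ>\<^sub>B bpow e r"
  by (cases r) (auto simp: bpow_def)

text \<open>The outer factor \<open>e\<close> feeds the first trailing argument to \<open>w\<close>;
  the remaining power feeds the others.\<close>

lemma absorber_bpow:
  assumes "absorber k 1 (lam_of e)" "0 < N"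
  shows "absorber k N (lam_of (bpow e N))"
  using assms(2)
proof (induction N rule: nat_induct_non_zero)
  case 1
  then show ?case using assms(1) by (simp add: bpow_def)
next
  case (Suc N)
  show ?case
    unfolding absorber_def
  proof (intro allI impI)
    fix y w and as vs :: "lam list"
    assume as: "length as = k" and "length vs = Suc N"
    then obtain v vs' where vs: "vs = v # vs'" "length vs' = N" by (auto simp: length_Suc_conv)
    let ?E = "lam_of (bpow e N)"
    have "apps (lam_of (bpow e (Suc N))) (y # as @ w # vs) =
        apps (lam_of B \<cdot> lam_of e \<cdot> ?E \<cdot> y) (as @ w # vs)"
      using Suc by (simp add: bpow_Suc bcomp_def)
    also have "\<dots> =\<^sub>\<beta>\<^sub>\<eta> apps (lam_of e \<cdot> (?E \<cdot> y)) (as @ w # vs)"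
      by (intro beta_eta_apps B_apply)
    also have "\<dots> = apps (apps (lam_of e) ((?E \<cdot> y) # as @ w # [v])) vs'"
      using vs by simp
    finally have 1: "apps (lam_of (bpow e (Suc N))) (y # as @ w # vs) =\<^sub>\<beta>\<^sub>\<eta>
      apps (apps (lam_of e) ((?E \<cdot> y) # as @ w # [v])) vs'" .
    have 2: "apps (apps (lam_of e) ((?E \<cdot> y) # as @ w # [v])) vs' =\<^sub>\<beta>\<^sub>\<eta>
      apps (apps (?E \<cdot> y) (as @ [apps w [v]])) vs'"
      by (intro beta_eta_apps absorberD[OF assms(1) as]) simp
    have 3: "apps ?E (y # as @ (w \<cdot> v) # vs') =\<^sub>\<beta>\<^sub>\<eta> apps y (as @ [apps (w \<cdot> v) vs'])"
      by (intro absorberD[OF Suc.IH as vs(2)])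
    show "apps (lam_of (bpow e (Suc N))) (y # as @ w # vs) =\<^sub>\<beta>\<^sub>\<eta> apps y (as @ [apps w vs])"
      using beta_eta_eq.trans[OF beta_eta_eq.trans[OF 1 2]] 3 vs by simp
  qed
qed

section \<open>Labelled forests under an absorber\<close>

lemma subst_lam_of [simp]: "subst (lam_of b) u c = lam_of b"
  by (induction b) auto

text \<open>Absorption regroups the variables without permuting them, and the root of the first tree
  becomes the head. Hence the numbering stays consecutive from 0.\<close>

lemma absorber_labs:
  assumes X: "absorber k N X" and "length as = k" "length vs = N"
  shows "apps X (labs (T us # as @ T ws # vs @ rest) 0)
    =\<^sub>\<beta>\<^sub>\<eta> lab (T (us @ as @ T (ws @ vs) # rest)) 0"
proof -
  have "apps (apps X (lab (T us) 0 # labs as m @ lab (T ws) m' # labs vs m'')) rs =\<^sub>\<beta>\<^sub>\<eta>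
      apps (apps (lab (T us) 0) (labs as m @ [apps (lab (T ws) m') (labs vs m'')])) rs" for m m' m'' rs
    using assms by (intro beta_eta_apps absorberD[OF X]) simp_all
  then show ?thesis by (simp add: add.assoc)
qed

text \<open>Applying \<open>Y\<close> to \<open>X\<close> puts \<open>X\<close> in place of the head
  variable; \<open>X\<close> then rearranges the forest \<open>F\<close> into
  \<open>F'\<close>.\<close>

lemma absorber_step:
  assumes X: "absorber k N X" and "length as = k" "length vs = N"
    and Y: "apps Y (map Var [0..<nodes (T F)]) =\<^sub>\<beta>\<^sub>\<eta> lab (T F) 0" "\<And>u c. subst Y u c = Y"
    and F: "F = T us # as @ T ws # vs @ rest" "F' = us @ as @ T (ws @ vs) # rest"
  shows "apps (Y \<cdot> X) (map Var [0..<nodes (T F')]) =\<^sub>\<beta>\<^sub>\<eta> lab (T F') 0"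
proof -
  \<comment> \<open>The root of the first tree takes over as head, so exactly one node is
    lost.\<close>
  have n: "nodes (T F) = Suc (nodes (T F'))" using F by simp
  have "map Var [0..<nodes (T F)] = Var 0 # map (\<lambda>x. Var (Suc x)) [0..<nodes (T F')]"
    unfolding n by (simp add: upt_conv_Cons comp_def flip: map_Suc_upt del: upt_Suc nodes.simps)
  then have "map (\<lambda>s. subst s X 0) (map Var [0..<nodes (T F)]) = X # map Var [0..<nodes (T F')]"
    by (simp add: comp_def del: nodes.simps upt_Suc)
  then have "apps Y (X # map Var [0..<nodes (T F')]) = subst (apps Y (map Var [0..<nodes (T F)])) X 0"
    using Y(2) by (simp del: nodes.simps upt_Suc)
  also have "\<dots> =\<^sub>\<beta>\<^sub>\<eta> subst (lab (T F) 0) X 0" by (intro beta_eta_subst Y)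
  also have "subst (lab (T F) 0) X 0 = apps X (labs F 0)"
    using subst_labs[of X F 0] by simp
  finally have "apps (Y \<cdot> X) (map Var [0..<nodes (T F')]) =\<^sub>\<beta>\<^sub>\<eta> apps X (labs F 0)"
    by (simp del: nodes.simps upt_Suc)
  then show ?thesis
    using absorber_labs[OF X assms(2,3), of us ws rest] beta_eta_eq.trans unfolding F by blast
qed

section \<open>The orbit of the forest\<close>

text \<open>All lengths of spines being \<open>0\<close> or \<open>N \<equiv> 0 (mod k + 2)\<close>, a subtree keeps its
  position modulo \<open>k + 2\<close> up to the shift by \<open>-1\<close> per step. So it suffices to require leaves
  at all positions congruent to \<open>k + 1\<close>, in the forest and in all spines, for the absorbing
  position \<open>k + 1\<close> to be a leaf at every step.\<close>

definition aligned :: "nat \<Rightarrow> tree list \<Rightarrow> bool" where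
  "aligned k ts \<longleftrightarrow> (\<forall>i<length ts. i mod (k + 2) = k + 1 \<longrightarrow> ts ! i = T [])"

fun good_tree :: "nat \<Rightarrow> nat \<Rightarrow> tree \<Rightarrow> bool" where
  "good_tree k N (T us) \<longleftrightarrow>
     (us = [] \<or> length us = N) \<and> aligned k us \<and> (\<forall>u\<in>set us. good_tree k N u)"

text \<open>The lengths are those left by a step: \<open>k\<close> kept trees, the absorbing tree,
  and the \<open>0\<close> or \<open>N\<close> arguments released by the first tree.\<close>

definition good :: "nat \<Rightarrow> nat \<Rightarrow> tree list \<Rightarrow> bool" where
  "good k N c \<longleftrightarrow> (length c = k + 1 \<or> length c = k + 1 + N) \<and> aligned k c \<and> (\<forall>t\<in>set c. good_tree k N t)"

text \<open>A step involves the first tree, \<open>k\<close> kept ones, the absorbing one and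
  \<open>N\<close> absorbed ones. The added leaves are further variables supplied as
  arguments.\<close>

definition pad :: "nat \<Rightarrow> nat \<Rightarrow> tree list \<Rightarrow> tree list" where
  "pad k N c = c @ replicate (k + N + 2 - length c) (T [])"

text \<open>One self-application. The absorbing tree, at index \<open>k\<close> of \<open>r\<close>, is presumed to be a leaf
  and is therefore not mentioned.\<close>

definition step :: "nat \<Rightarrow> nat \<Rightarrow> tree list \<Rightarrow> tree list" where
  "step k N c = (case pad k N c of T us # r \<Rightarrow> us @ take k r @ [T (drop (Suc k) r)])"

lemma good_split:
  assumes "good k N c"
  obtains us as vs where "pad k N c = T us # as @ T [] # vs" "length as = k" "length vs = N"
    "step k N c = us @ as @ [T vs]" "us = [] \<or> length us = N" "aligned k us" "aligned k (pad k N c)"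
    "\<forall>t\<in>set (T us # as @ T [] # vs). good_tree k N t" "hd c = T us"
proof -
  have len: "length (pad k N c) = k + N + 2" using assms by (auto simp: pad_def good_def)
  have al: "aligned k (pad k N c)"
    using assms by (auto simp: aligned_def pad_def good_def nth_append)
  have gt: "\<forall>t\<in>set (pad k N c). good_tree k N t"
    using assms by (auto simp: pad_def good_def aligned_def)
  obtain us r where r: "pad k N c = T us # r"
    using len tree.exhaust by (cases "pad k N c") (simp, metis)
  have lr: "length r = k + N + 1" using len r by simp
  \<comment> \<open>The absorbing position \<open>k + 1\<close> is the smallest one that alignment
    forces to be a leaf.\<close>
  have "pad k N c ! Suc k = T []" using al len by (simp add: aligned_def)
  then have "r ! k = T []" using r by simp
  then have sp: "r = take k r @ T [] # drop (Suc k) r"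
    using id_take_nth_drop[of k r] lr by simp
  have "c \<noteq> []" using assms by (auto simp: good_def)
  then have "hd c = T us" using r by (cases c) (auto simp: pad_def)
  moreover have "good_tree k N (T us)" using gt r by simp
  moreover have "step k N c = us @ take k r @ [T (drop (Suc k) r)]" using r by (simp add: step_def)
  ultimately show thesis
    using that[of us "take k r" "drop (Suc k) r"] r sp lr al gt by auto
qed

lemma good_step:
  assumes N: "(k + 2) dvd N" and c: "good k N c"
  shows "good k N (step k N c)"
proof -
  obtain us as vs where *: "pad k N c = T us # as @ T [] # vs" "length as = k" "length vs = N"
    "step k N c = us @ as @ [T vs]" "us = [] \<or> length us = N" "aligned k us" "aligned k (pad k N c)"
    "\<forall>t\<in>set (T us # as @ T [] # vs). good_tree k N t" using good_split[OF c] by metis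
  \<comment> \<open>In the padded forest \<open>vs\<close> starts at position \<open>k + 2\<close>,
    a full period, so residues are unchanged.\<close>
  have al_vs: "aligned k vs"
    unfolding aligned_def
  proof (intro allI impI)
    fix i assume i: "i < length vs" "i mod (k + 2) = k + 1"
    have "(k + 2 + i) mod (k + 2) = k + 1" by (metis i(2) mod_add_self1)
    moreover have "pad k N c ! (k + 2 + i) = vs ! i" "k + 2 + i < length (pad k N c)"
      using * i by (auto simp: nth_append nth_Cons')
    ultimately show "vs ! i = T []" using *(7) unfolding aligned_def by metis
  qed
  have "aligned k (us @ as @ [T vs])"
    unfolding aligned_def
  proof (intro allI impI)
    fix i assume i: "i < length (us @ as @ [T vs])" "i mod (k + 2) = k + 1"
    \<comment> \<open>The length of \<open>us\<close> is a multiple of \<open>k + 2\<close>, so the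
      \<open>k + 1\<close> trees after it occupy residues \<open>0\<close> to \<open>k\<close>
      only.\<close>
    have "i < length us"
    proof (rule ccontr)
      assume "\<not> i < length us"
      then obtain j where j: "i = length us + j" by (metis le_Suc_ex not_less)
      have "(k + 2) dvd length us" using * N by auto
      then have "i mod (k + 2) = j mod (k + 2)" unfolding j by (metis dvd_imp_mod_0 mod_add_left_eq add_0)
      moreover have "j \<le> k" using i j * by simp
      ultimately show False using i by simp
    qed
    then show "(us @ as @ [T vs]) ! i = T []" using *(6) i by (simp add: aligned_def nth_append)
  qed
  then show ?thesis using * al_vs by (auto simp: good_def)
qed

text \<open>\<open>edges (T c) - length c\<close> counts the edges inside the trees of \<open>c\<close>. A step adds \<open>N\<close> of them
  and removes as many as the first spine has, \<open>0\<close> or \<open>N\<close>; in the latter case the left depth drops.\<close>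

definition precedes :: "tree list \<Rightarrow> tree list \<Rightarrow> bool" where
  "precedes c d \<longleftrightarrow> edges (T c) - length c < edges (T d) - length d \<or>
     edges (T c) - length c = edges (T d) - length d \<and> left_depth (hd d) < left_depth (hd c)"

lemma precedes_step:
  assumes N: "0 < N" and c: "good k N c"
  shows "precedes c (step k N c)"
proof -
  obtain us as vs where *: "pad k N c = T us # as @ T [] # vs" "length as = k" "length vs = N"
    "step k N c = us @ as @ [T vs]" "us = [] \<or> length us = N" "hd c = T us" using good_split[OF c] by metis
  have "sum_list (map edges c) = sum_list (map edges (pad k N c))"
    by (simp add: pad_def sum_list_replicate)
  then have e: "sum_list (map edges (step k N c)) + length us = sum_list (map edges c) + N"
    using * by simp
  show ?thesis
  proof (cases us)
    case Nil
    then show ?thesis using e N by (simp add: precedes_def)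
  next
    \<comment> \<open>The edge count is unchanged, and the new first tree \<open>u\<close> is the
      leftmost child of the old one.\<close>
    case (Cons u us')
    then show ?thesis using e * by (simp add: precedes_def)
  qed
qed

lemma precedes_trans: "precedes c d \<Longrightarrow> precedes d e \<Longrightarrow> precedes c e"
  by (auto simp: precedes_def)

text \<open>Trailing leaves affect neither the count of inner edges nor the first tree of a nonempty
  forest, the two quantities compared.\<close>

lemma precedes_irrefl:
  assumes "c \<noteq> []" "d \<noteq> []" "c @ replicate m (T []) = d @ replicate m' (T [])"
  shows "\<not> precedes c d"
proof -
  have "sum_list (map edges (c @ replicate m (T []))) = sum_list (map edges (d @ replicate m' (T [])))"
    using assms by simp
  moreover have "hd c = hd d" using assms by (metis hd_append2)
  ultimately show ?thesis by (simp add: precedes_def sum_list_replicate)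
qed

text \<open>The initial forest is that of \<open>X\<close> itself, so index \<open>i\<close> belongs
  to \<open>i + 1\<close> copies of \<open>X\<close>.\<close>

definition orbit :: "nat \<Rightarrow> nat \<Rightarrow> nat \<Rightarrow> tree list" where
  "orbit k N i = (step k N ^^ i) (replicate k (T []) @ [T (replicate N (T []))])"

lemma good_orbit:
  assumes "(k + 2) dvd N"
  shows "good k N (orbit k N i)"
proof (induction i)
  case 0
  show ?case by (auto simp: orbit_def good_def aligned_def nth_append)
next
  case (Suc i)
  then show ?case using good_step[OF assms] by (simp add: orbit_def)
qed

lemma precedes_orbit:
  assumes "(k + 2) dvd N" "0 < N" "i < j"
  shows "precedes (orbit k N i) (orbit k N j)"
proof -
  have "precedes (orbit k N i) (orbit k N (Suc i))" for i
    using precedes_step[OF assms(2) good_orbit[OF assms(1)]] by (simp add: orbit_def)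
  with assms(3) show ?thesis
    by (induction rule: less_Suc_induct) (auto intro: precedes_trans)
qed

section \<open>Self-applications and the orbit\<close>

lemma self_app_1: "self_app X (Suc 0) = X"
  by (simp add: self_app_def)

lemma self_app_Suc: "self_app X (Suc (Suc i)) = self_app X (Suc i) \<cdot> X"
  by (simp add: self_app_def)

text \<open>The number \<open>m\<close> of extra leaves is arbitrary because a step may consume
  leaves padding the preceding forest, and two orbit members must later be brought to the same
  number of variables.\<close>

lemma apps_self_app_orbit:
  assumes "(k + 2) dvd N" and X: "absorber k N X" "\<And>u c. subst X u c = X"
  shows "apps (self_app X (Suc i)) (map Var [0..<nodes (T (orbit k N i @ replicate m (T [])))])
    =\<^sub>\<beta>\<^sub>\<eta> lab (T (orbit k N i @ replicate m (T []))) 0"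
proof (induction i arbitrary: m)
  case 0
  let ?F = "T [] # replicate k (T []) @ T [] # replicate N (T []) @ replicate m (T [])"
  have "?F = replicate (nodes (T (orbit k N 0 @ replicate m (T [])))) (T [])"
    by (simp add: orbit_def sum_list_replicate replicate_add replicate_app_Cons_same)
  then have "labs ?F 0 = map Var [0..<nodes (T (orbit k N 0 @ replicate m (T [])))]"
    by (simp only: labs_replicate_leaf add_0)
  moreover have "orbit k N 0 @ replicate m (T []) =
      [] @ replicate k (T []) @ T ([] @ replicate N (T [])) # replicate m (T [])"
    by (simp add: orbit_def)
  then have "apps X (labs ?F 0) =\<^sub>\<beta>\<^sub>\<eta> lab (T (orbit k N 0 @ replicate m (T []))) 0"
    using absorber_labs[OF X(1) length_replicate length_replicate] by metis
  ultimately show ?case by (simp only: self_app_1)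
next
  case (Suc i)
  let ?c = "orbit k N i"
  obtain us as vs where *: "pad k N ?c = T us # as @ T [] # vs" "length as = k" "length vs = N"
    "step k N ?c = us @ as @ [T vs]" using good_split[OF good_orbit[OF assms(1)]] by metis
  \<comment> \<open>The preceding forest receives the leaves needed for one step, and
    \<open>m\<close> more that survive it.\<close>
  define F where "F = ?c @ replicate (k + N + 2 - length ?c + m) (T [])"
  have cl: "subst (self_app X (Suc i)) u c = self_app X (Suc i)" for u c
    by (induction i) (simp_all add: self_app_1 self_app_Suc X)
  have "F = pad k N ?c @ replicate m (T [])" by (simp add: F_def pad_def replicate_add)
  then have F: "F = T us # as @ T [] # vs @ replicate m (T [])" using * by simp
  have "orbit k N (Suc i) @ replicate m (T []) = us @ as @ T ([] @ vs) # replicate m (T [])"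
    using * by (simp add: orbit_def)
  from absorber_step[OF X(1) *(2,3) _ cl F this] Suc show ?case
    unfolding F_def self_app_Suc by blast
qed

theorem theorem3p11:
  fixes k n :: nat
  assumes "n > 0"
  shows "\<not> rho_property (lam_of (bpow (B_iter k) ((k + 2) * n)))"
proof
  define N X where "N = (k + 2) * n" and "X = lam_of (bpow (B_iter k) N)"
  have N: "(k + 2) dvd N" "0 < N"
    unfolding N_def by (rule dvd_triv_left) (use assms in simp)
  have X: "absorber k N X" "\<And>u c. subst X u c = X"
    unfolding X_def using absorber_bpow absorber_B_iter N by auto
  assume "rho_property (lam_of (bpow (B_iter k) ((k + 2) * n)))"
  then have "rho_property X" by (simp add: X_def N_def)
  then obtain i' j' where ij': "0 < i'" "0 < j'" "i' \<noteq> j'" "self_app X i' =\<^sub>\<beta>\<^sub>\<eta> self_app X j'"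
    unfolding rho_property_def by blast
  have "\<exists>i j. i < j \<and> self_app X (Suc i) =\<^sub>\<beta>\<^sub>\<eta> self_app X (Suc j)"
  proof (cases "i' < j'")
    case True
    then show ?thesis using ij' by (intro exI[of _ "i' - 1"] exI[of _ "j' - 1"]) auto
  next
    case False
    then show ?thesis using ij' beta_eta_eq.sym by (intro exI[of _ "j' - 1"] exI[of _ "i' - 1"]) auto
  qed
  then obtain i j where ij: "i < j" "self_app X (Suc i) =\<^sub>\<beta>\<^sub>\<eta> self_app X (Suc j)" by blast
  define c d where "c = orbit k N i" and "d = orbit k N j"
  \<comment> \<open>Padding each forest by the node count of the other equalises the number of
    variables.\<close>
  define s t where "s = T (c @ replicate (nodes (T d)) (T []))"
    and "t = T (d @ replicate (nodes (T c)) (T []))"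
  have "nodes s = nodes t" by (simp add: s_def t_def sum_list_replicate)
  moreover have "apps (self_app X (Suc i)) (map Var [0..<nodes s]) =\<^sub>\<beta>\<^sub>\<eta> lab s 0"
    "apps (self_app X (Suc j)) (map Var [0..<nodes t]) =\<^sub>\<beta>\<^sub>\<eta> lab t 0"
    unfolding s_def t_def c_def d_def using apps_self_app_orbit[OF N(1) X] by blast+
  ultimately have "lab s 0 =\<^sub>\<beta>\<^sub>\<eta> lab t 0"
    using beta_eta_apps[OF ij(2), of "map Var [0..<nodes t]"] by (metis beta_eta_eq.sym beta_eta_eq.trans)
  then have "s = t" using lab_inject lamfree_eq lamfree_lab by blast
  moreover have "c \<noteq> []" "d \<noteq> []"
    using good_orbit[OF N(1), of i] good_orbit[OF N(1), of j] by (auto simp: c_def d_def good_def)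
  ultimately have "\<not> precedes c d" using precedes_irrefl unfolding s_def t_def by blast
  then show False using precedes_orbit[OF N ij(1)] by (simp add: c_def d_def)
qed

end
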